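(* Let $n\ge 3$ be an integer and let $r$ be a real number with $n-2\le r<n-1$. Then $\overline{M}_{n,r}$ is homeomorphic to the real projective space $\mathbb{R}P^{n-3}$.
   Context: Let $d$ denote Euclidean distance in the plane $\mathbb{R}^2$. Fix $\mathbf{x}_0=(0,0)$ and $\mathbf{x}_{n-1}=(r,0)$. Define $$M_{n,r}=\{(\mathbf{x}_1,\ldots,\mathbf{x}_{n-2})\in(\mathbb{R}^2)^{n-2}: d(\mathbf{x}_{i-1},\mathbf{x}_i)=1 \text{ for all } 1\le i\le n-1\},$$ with the subspace topology from $(\mathbb{R}^2)^{n-2}$. This is the moduli space of oriented $n$-gons in the plane (sides are allowed to intersect) with one side of length $r$ and the remaining $n-1$ sides of length $1$, modulo orientation-preserving isometries of the plane; each such polygon is uniquely normalized so that its side of length $r$ is oriented in the negative $x$-direction, going from $(r,0)$ to $(0,0)$. The space $\overline{M}_{n,r}$ of isometry classes of planar polygons with $n-1$ sides of length $1$ and one side of length $r$ is defined as the quotient space (with the quotient topology) of $M_{n,r}$ by the involution given by reflection across the $x$-axis, $(\mathbf{x}_1,\ldots,\mathbf{x}_{n-2})\mapsto(\rho(\mathbf{x}_1),\ldots,\rho(\mathbf{x}_{n-2}))$ with $\rho(x,y)=(x,-y)$. $\mathbb{R}P^{n-3}$ is the space of lines through the origin in $\mathbb{R}^{n-2}$, i.e. the quotient of the unit sphere $S^{n-3}\subset\mathbb{R}^{n-2}$ by the antipodal map. *)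

theory Defs
  imports "HOL-Analysis.Analysis"
begin

text \<open>Quotient of a topological space by an equivalence relation on its underlying set: the points
  are the equivalence classes, and a set of classes is open iff its preimage under the projection
  \<open>x \<mapsto> R `` {x}\<close> is open.\<close>

definition quotient_topology :: "'a topology \<Rightarrow> ('a \<times> 'a) set \<Rightarrow> 'a set topology" where
  "quotient_topology X R =
     topology (\<lambda>U. U \<subseteq> topspace X // R \<and> openin X {x \<in> topspace X. R `` {x} \<in> U})"

lemma openin_quotient_topology:
  "openin (quotient_topology X R) U \<longleftrightarrow>
     U \<subseteq> topspace X // R \<and> openin X {x \<in> topspace X. R `` {x} \<in> U}"
proof -
  let ?P = "\<lambda>U. {x \<in> topspace X. R `` {x} \<in> U}"
  have "?P (S \<inter> T) = ?P S \<inter> ?P T" for S T by auto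
  moreover have "?P (\<Union>K) = \<Union>(?P ` K)" for K by auto
  ultimately have "istopology (\<lambda>U. U \<subseteq> topspace X // R \<and> openin X (?P U))"
    unfolding istopology_def by (auto intro!: openin_Union)
  then show ?thesis
    unfolding quotient_topology_def by (simp add: topology_inverse')
qed

lemma topspace_quotient_topology: "topspace (quotient_topology X R) = topspace X // R"
proof -
  have "{x \<in> topspace X. R `` {x} \<in> topspace X // R} = topspace X"
    by (auto simp: quotientI)
  then have "openin (quotient_topology X R) (topspace X // R)"
    by (simp add: openin_quotient_topology)
  then show ?thesis
    using openin_quotient_topology[of X R] by (meson openin_subset openin_topspace subset_antisym)
qed

lemma quotient_map_quotient_topology:
  "quotient_map X (quotient_topology X R) (\<lambda>x. R `` {x})"
  by (auto simp: quotient_map_def topspace_quotient_topology openin_quotient_topology quotient_def)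

definition involution_rel :: "'a set \<Rightarrow> ('a \<Rightarrow> 'a) \<Rightarrow> ('a \<times> 'a) set" where
  "involution_rel S f = {(p, q). p \<in> S \<and> q \<in> S \<and> (q = p \<or> q = f p)}"

lemma equiv_involution_rel:
  assumes "\<And>p. p \<in> S \<Longrightarrow> f (f p) = p"
  shows "equiv S (involution_rel S f)"
  using assms by (auto simp: equiv_def refl_on_def sym_def trans_def involution_rel_def)

text \<open>\<open>x\<close> lists only the free vertices, indexed by \<open>{1..n-2}\<close>; the two remaining vertices are
  pinned to the endpoints of the side of length \<open>r\<close>.\<close>

definition polygon_vertex :: "nat \<Rightarrow> real \<Rightarrow> (nat \<Rightarrow> real \<times> real) \<Rightarrow> nat \<Rightarrow> real \<times> real" where
  "polygon_vertex n r x i = (if i = 0 then (0, 0) else if i = n - 1 then (r, 0) else x i)"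

text \<open>The ambient space \<open>(\<real>\<^sup>2)\<^bsup>n-2\<^esup>\<close> is a product topology, so its points are functions that are
  \<open>undefined\<close> outside \<open>{1..n-2}\<close>. The metric of \<open>real \<times> real\<close> is the Euclidean one.\<close>

definition oriented_polygon_space :: "nat \<Rightarrow> real \<Rightarrow> (nat \<Rightarrow> real \<times> real) topology" where
  "oriented_polygon_space n r =
     subtopology (product_topology (\<lambda>_. euclidean) {1..n-2})
       {x. \<forall>i\<in>{1..n-1}. dist (polygon_vertex n r x (i - 1)) (polygon_vertex n r x i) = 1}"

definition reflect_polygon :: "nat \<Rightarrow> (nat \<Rightarrow> real \<times> real) \<Rightarrow> nat \<Rightarrow> real \<times> real" where
  "reflect_polygon n x = (\<lambda>i\<in>{1..n-2}. (fst (x i), - snd (x i)))"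

definition polygon_space :: "nat \<Rightarrow> real \<Rightarrow> (nat \<Rightarrow> real \<times> real) set topology" where
  "polygon_space n r =
     quotient_topology (oriented_polygon_space n r)
       (involution_rel (topspace (oriented_polygon_space n r)) (reflect_polygon n))"

lemma topspace_oriented_polygon_space:
  "topspace (oriented_polygon_space n r) =
     {x \<in> {1..n-2} \<rightarrow>\<^sub>E UNIV.
        \<forall>i\<in>{1..n-1}. dist (polygon_vertex n r x (i - 1)) (polygon_vertex n r x i) = 1}"
  by (auto simp: oriented_polygon_space_def)

lemma reflect_polygon_involution:
  "x \<in> topspace (oriented_polygon_space n r) \<Longrightarrow> reflect_polygon n (reflect_polygon n x) = x"
  by (auto simp: topspace_oriented_polygon_space reflect_polygon_def PiE_def extensional_def
      restrict_def fun_eq_iff)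

lemma reflect_polygon_in_topspace:
  assumes x: "x \<in> topspace (oriented_polygon_space n r)"
  shows "reflect_polygon n x \<in> topspace (oriented_polygon_space n r)"
proof -
  let ?\<rho> = "\<lambda>p :: real \<times> real. (fst p, - snd p)"
  have v: "polygon_vertex n r (reflect_polygon n x) i = ?\<rho> (polygon_vertex n r x i)"
    if "i \<le> n - 1" for i
    using that by (auto simp: polygon_vertex_def reflect_polygon_def)
  have d: "dist (?\<rho> p) (?\<rho> q) = dist p q" for p q
    by (simp add: dist_prod_def dist_real_def abs_minus_commute)
  have "dist (polygon_vertex n r (reflect_polygon n x) (i - 1))
      (polygon_vertex n r (reflect_polygon n x) i) = 1" if i: "i \<in> {1..n-1}" for i
  proof -
    have "i - 1 \<le> n - 1" "i \<le> n - 1" using i by auto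
    then show ?thesis using x i by (simp add: v d topspace_oriented_polygon_space del: dist_Pair_Pair)
  qed
  then show ?thesis
    by (auto simp: topspace_oriented_polygon_space reflect_polygon_def)
qed

lemma equiv_reflect_polygon:
  "equiv (topspace (oriented_polygon_space n r))
     (involution_rel (topspace (oriented_polygon_space n r)) (reflect_polygon n))"
  by (rule equiv_involution_rel) (rule reflect_polygon_involution)

text \<open>The library's \<open>nsphere m\<close> is the unit sphere of \<open>\<real>\<^bsup>m+1\<^esup>\<close>, realised as sequences that vanish
  from index \<open>m + 1\<close> on.\<close>

definition real_projective_space :: "nat \<Rightarrow> (nat \<Rightarrow> real) set topology" where
  "real_projective_space m =
     quotient_topology (nsphere m) (involution_rel (topspace (nsphere m)) (\<lambda>x i. - x i))"

lemma equiv_antipodal: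
  "equiv (topspace (nsphere m)) (involution_rel (topspace (nsphere m)) (\<lambda>x i. - x i))"
  by (rule equiv_involution_rel) simp

end

theory Submission
  imports Defs
begin

text \<open>Let \<open>(dx\<^sub>i, dy\<^sub>i)\<close> be the unit sides of a polygon. Since \<open>n - 1\<close> numbers \<open>dx\<^sub>i \<le> 1\<close> add up to
  \<open>r \<ge> n - 2\<close>, each \<open>dx\<^sub>i\<close> is nonnegative and hence equal to \<open>sqrt (1 - dy\<^sub>i\<^sup>2)\<close>, so the heights
  of the \<open>n - 2\<close> free vertices determine the polygon. On the ray through a nonzero height vector the
  width \<open>\<Sum> sqrt (1 - dy\<^sub>i\<^sup>2)\<close> decreases strictly from \<open>n - 1 > r\<close> to a value that is at most \<open>n - 2\<close>
  where the first \<open>\<bar>dy\<^sub>i\<bar>\<close> reaches \<open>1\<close>, so it equals \<open>r\<close> exactly once. Normalising the height vector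
  is therefore a homeomorphism from \<open>M\<^bsub>n,r\<^esub>\<close> onto \<open>S\<^bsup>n-3\<^esup>\<close>, and it turns the reflection into the
  antipodal map.\<close>

section \<open>Homeomorphisms between quotients\<close>

text \<open>Since \<open>h\<close> carries classes onto classes, direct image under \<open>h\<close>
  is a bijection of the quotients. It is a quotient map because \<open>h\<close> is one, and an
  injective quotient map is a homeomorphism.\<close>

lemma homeomorphic_space_quotient_topology:
  assumes h: "homeomorphic_map X Y h"
    and R: "\<And>x. x \<in> topspace X \<Longrightarrow> R `` {x} \<subseteq> topspace X"
    and RS: "\<And>x. x \<in> topspace X \<Longrightarrow> h ` (R `` {x}) = S `` {h x}"
  shows "quotient_topology X R homeomorphic_space quotient_topology Y S"
proof -
  have Yeq: "topspace Y = h ` topspace X"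
    using h by (simp add: homeomorphic_imp_surjective_map)
  have inj: "inj_on h (topspace X)"
    using h by (simp add: homeomorphic_imp_injective_map)
  have quot: "quotient_map X Y h"
    using h by (simp add: homeomorphic_map_def)
  have sub: "C \<subseteq> topspace X" if "C \<in> topspace X // R" for C
    using that R by (auto elim!: quotientE)
  have img: "(`) h ` (topspace X // R) = topspace Y // S"
    by (auto simp: quotient_def Yeq RS image_iff)
  have "quotient_map (quotient_topology X R) (quotient_topology Y S) ((`) h)"
    unfolding quotient_map_def topspace_quotient_topology
  proof (intro conjI allI impI)
    show "(`) h ` (topspace X // R) = topspace Y // S" by (rule img)
    fix U assume U: "U \<subseteq> topspace Y // S"
    let ?V = "{y \<in> topspace Y. S `` {y} \<in> U}"
    have "{x \<in> topspace X. R `` {x} \<in> {C \<in> topspace X // R. h ` C \<in> U}}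
        = {x \<in> topspace X. h x \<in> ?V}"
      using RS by (auto simp: quotientI Yeq)
    moreover have "openin X {x \<in> topspace X. h x \<in> ?V} \<longleftrightarrow> openin Y ?V"
      by (rule quot[unfolded quotient_map_def, THEN conjunct2, rule_format]) blast
    ultimately show "openin (quotient_topology X R) {C \<in> topspace X // R. h ` C \<in> U}
        \<longleftrightarrow> openin (quotient_topology Y S) U"
      using U by (simp add: openin_quotient_topology)
  qed
  moreover have "inj_on ((`) h) (topspace X // R)"
    by (meson inj inj_onI inj_on_image_eq_iff sub)
  ultimately have "homeomorphic_map (quotient_topology X R) (quotient_topology Y S) ((`) h)"
    by (simp add: homeomorphic_map_def topspace_quotient_topology)
  then show ?thesis by (rule homeomorphic_map_imp_homeomorphic_space)
qed

section \<open>The width along a ray\<close>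

text \<open>No summand grows with the scale, and those with \<open>w a\<close> nonzero drop. As
  \<open>sqrt\<close> is odd and strictly increasing on all reals, negative radicands do no
  harm.\<close>

lemma sum_sqrt_scale_strict_antimono:
  fixes w :: "'a \<Rightarrow> real"
  assumes "finite A" "0 \<le> s" "s < t" "\<exists>a\<in>A. w a \<noteq> 0"
  shows "(\<Sum>a\<in>A. sqrt (1 - (t * w a)\<^sup>2)) < (\<Sum>a\<in>A. sqrt (1 - (s * w a)\<^sup>2))"
proof (rule sum_strict_mono_ex1)
  have lt: "s\<^sup>2 < t\<^sup>2" using assms by (simp add: power_strict_mono)
  show "\<forall>a\<in>A. sqrt (1 - (t * w a)\<^sup>2) \<le> sqrt (1 - (s * w a)\<^sup>2)"
    using lt by (auto simp: power_mult_distrib intro!: mult_right_mono)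
  obtain a where "a \<in> A" "w a \<noteq> 0" using assms by blast
  then show "\<exists>a\<in>A. sqrt (1 - (t * w a)\<^sup>2) < sqrt (1 - (s * w a)\<^sup>2)"
    using lt by (auto simp: power_mult_distrib intro!: bexI[of _ a])
qed (use assms in auto)

lemma ex_sum_sqrt_scale_eq:
  fixes w :: "'a \<Rightarrow> real"
  assumes A: "finite A" and w: "\<exists>a\<in>A. w a \<noteq> 0"
    and r: "real (card A) - 1 \<le> r" "r < real (card A)"
  shows "\<exists>t>0. (\<forall>a\<in>A. \<bar>t * w a\<bar> \<le> 1) \<and> (\<Sum>a\<in>A. sqrt (1 - (t * w a)\<^sup>2)) = r"
proof -
  let ?f = "\<lambda>t. \<Sum>a\<in>A. sqrt (1 - (t * w a)\<^sup>2)"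
  \<comment> \<open>At scale \<open>1 / W\<close> the largest entry reaches absolute value 1 and no
    entry exceeds it, so the intermediate value theorem is applied between 0 and
    \<open>1 / W\<close>.\<close>
  define W where "W = Max ((\<lambda>a. \<bar>w a\<bar>) ` A)"
  have le: "\<bar>w a\<bar> \<le> W" if "a \<in> A" for a
    unfolding W_def using A that by auto
  have W0: "W > 0" using w le by force
  have "W \<in> (\<lambda>a. \<bar>w a\<bar>) ` A"
    unfolding W_def using A w by (intro Max_in) auto
  then obtain b where b: "b \<in> A" "\<bar>w b\<bar> = W" by auto
  have "(1 / W * w b)\<^sup>2 = 1"
    using b W0 by (auto simp: power_divide simp flip: power2_abs[of "w b"])
  \<comment> \<open>The term of \<open>b\<close> is \<open>sqrt 0\<close>; each of the others is at
    most 1.\<close>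
  then have "?f (1 / W) = (\<Sum>a\<in>A - {b}. sqrt (1 - (1 / W * w a)\<^sup>2))"
    using A b by (simp add: sum.remove)
  also have "\<dots> \<le> (\<Sum>a\<in>A - {b}. 1)"
    by (intro sum_mono) simp
  also have "\<dots> = real (card A) - 1"
    using card.remove[OF A b(1)] by simp
  finally have lo: "?f (1 / W) \<le> r" using r by simp
  have "\<exists>t\<ge>0. t \<le> 1 / W \<and> ?f t = r"
    using lo r W0 by (intro IVT2') (auto intro!: continuous_intros)
  then obtain t where t: "0 \<le> t" "t \<le> 1 / W" "?f t = r" by blast
  \<comment> \<open>At \<open>t = 0\<close> the sum is \<open>card A\<close>, which exceeds
    \<open>r\<close>.\<close>
  have "t \<noteq> 0" using t r by auto
  moreover have "\<bar>t * w a\<bar> \<le> 1" if "a \<in> A" for a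
  proof -
    have "t * \<bar>w a\<bar> \<le> 1 / W * W"
      using t W0 le[OF that] by (intro mult_mono) auto
    then show ?thesis using t W0 by (simp add: abs_mult)
  qed
  ultimately show ?thesis using t by (intro exI[of _ t]) auto
qed

section \<open>Polygons described by their heights\<close>

text \<open>Vertical component of side \<open>j\<close>. The default 0 is the height of the pinned
  vertex 0; for the last side, \<open>v (Suc m)\<close> has to be 0, the height of the other pinned
  vertex.\<close>

definition gap :: "(nat \<Rightarrow> real) \<Rightarrow> nat \<Rightarrow> real" where
  "gap v j = v j - (case j of 0 \<Rightarrow> 0 | Suc i \<Rightarrow> v i)"

lemma gap_scale: "gap (\<lambda>i. t * v i) j = t * gap v j"
  by (simp add: gap_def algebra_simps split: nat.split)

lemma sum_gap: "(\<Sum>j\<le>i. gap v j) = v i"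
  by (induction i) (auto simp: gap_def)

text \<open>Free vertex number \<open>i + 1\<close> contributes coordinate \<open>i\<close>, as \<open>nsphere\<close> counts from \<open>0\<close>.\<close>

definition heights :: "nat \<Rightarrow> (nat \<Rightarrow> real \<times> real) \<Rightarrow> nat \<Rightarrow> real" where
  "heights m x i = (if i \<le> m then snd (x (Suc i)) else 0)"

text \<open>Horizontal component of a unit side that does not run backwards.\<close>

abbreviation run :: "(nat \<Rightarrow> real) \<Rightarrow> nat \<Rightarrow> real" where
  "run v j \<equiv> sqrt (1 - (gap v j)\<^sup>2)"

text \<open>With \<open>n = m + 3\<close> the unit sides are numbered from 0 to
  \<open>Suc m\<close>. The last one ends at a pinned vertex, which fits \<open>heights\<close>
  vanishing beyond \<open>m\<close>.\<close>

lemma snd_polygon_vertex_diff: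
  assumes "j \<le> Suc m"
  shows "snd (polygon_vertex (m + 3) r x (Suc j)) - snd (polygon_vertex (m + 3) r x j)
    = gap (heights m x) j"
  using assms by (auto simp: polygon_vertex_def gap_def heights_def split: nat.split)

text \<open>The lower bound on \<open>r\<close> keeps every side from running backwards, so the
  heights fix all horizontal components. They remain as the only free data, subject to bounds on the
  gaps and one equation for the width.\<close>

lemma mem_oriented_polygon_space_iff:
  assumes r: "real m + 1 \<le> r"
  shows "x \<in> topspace (oriented_polygon_space (m + 3) r) \<longleftrightarrow>
    x \<in> extensional {1..Suc m} \<and> (\<forall>j\<le>Suc m. \<bar>gap (heights m x) j\<bar> \<le> 1) \<and>
    (\<Sum>j\<le>Suc m. run (heights m x) j) = r \<and>
    (\<forall>i\<le>m. fst (x (Suc i)) = (\<Sum>j\<le>i. run (heights m x) j))"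
    (is "?L \<longleftrightarrow> _ \<and> ?g \<and> ?s \<and> ?f")
proof -
  let ?p = "polygon_vertex (m + 3) r x"
  let ?a = "\<lambda>i. fst (?p i)" and ?b = "\<lambda>j. gap (heights m x) j"
  have p0: "?a 0 = 0" and pr: "?a (m + 2) = r"
    by (simp_all add: polygon_vertex_def)
  have pf: "?a (Suc i) = fst (x (Suc i))" if "i \<le> m" for i
    using that by (simp add: polygon_vertex_def)
  have dist1: "dist (?p j) (?p (Suc j)) = 1 \<longleftrightarrow> (?a (Suc j) - ?a j)\<^sup>2 + (?b j)\<^sup>2 = 1"
    if "j \<le> Suc m" for j
    using snd_polygon_vertex_diff[OF that, of r x]
    by (simp add: dist_prod_def dist_real_def) (metis power2_commute)
  have "(\<forall>i\<in>{1..m + 3 - 1}. dist (?p (i - 1)) (?p i) = 1)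
      \<longleftrightarrow> (\<forall>j\<le>Suc m. dist (?p j) (?p (Suc j)) = 1)"
  proof -
    have "{1..m + 3 - 1} = Suc ` {..Suc m}" by (simp only: image_Suc_atMost) simp
    then show ?thesis by (simp only: ball_simps) (simp add: Ball_def)
  qed
  then have L: "?L \<longleftrightarrow> x \<in> extensional {1..Suc m} \<and>
      (\<forall>j\<le>Suc m. (?a (Suc j) - ?a j)\<^sup>2 + (?b j)\<^sup>2 = 1)"
    using dist1 by (auto simp: topspace_oriented_polygon_space PiE_def)
  have "?g \<and> ?s \<and> ?f" if sq: "\<forall>j\<le>Suc m. (?a (Suc j) - ?a j)\<^sup>2 + (?b j)\<^sup>2 = 1"
  proof -
    have le1: "?a (Suc j) - ?a j \<le> 1" if "j \<le> Suc m" for j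
    proof -
      have "(?a (Suc j) - ?a j)\<^sup>2 \<le> 1" using sq that by (smt (verit) zero_le_power2)
      then show ?thesis by (simp add: abs_square_le_1 abs_le_iff)
    qed
    have tel: "(\<Sum>j\<le>i. ?a (Suc j) - ?a j) = ?a (Suc i)" for i
      using p0 by (induction i) auto
    have ge0: "0 \<le> ?a (Suc j) - ?a j" if j: "j \<le> Suc m" for j
    proof -
      \<comment> \<open>The other \<open>m + 1\<close> sides advance by at most 1 each, hence by at
        most \<open>r\<close> in total, which leaves a nonnegative advance for side
        \<open>j\<close>.\<close>
      have "r = (\<Sum>j\<le>Suc m. ?a (Suc j) - ?a j)" using tel pr by simp
      also have "\<dots> = (?a (Suc j) - ?a j) + (\<Sum>k\<in>{..Suc m} - {j}. ?a (Suc k) - ?a k)"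
        using j by (intro sum.remove) auto
      also have "(\<Sum>k\<in>{..Suc m} - {j}. ?a (Suc k) - ?a k) \<le> (\<Sum>k\<in>{..Suc m} - {j}. 1)"
        using le1 by (intro sum_mono) auto
      also have "\<dots> = real m + 1" using j by simp
      finally show ?thesis using r by simp
    qed
    have run: "run (heights m x) j = ?a (Suc j) - ?a j" if "j \<le> Suc m" for j
    proof -
      have "1 - (?b j)\<^sup>2 = (?a (Suc j) - ?a j)\<^sup>2" using sq that by (simp add: algebra_simps)
      then show ?thesis using ge0[OF that] by simp
    qed
    have "\<bar>?b j\<bar> \<le> 1" if "j \<le> Suc m" for j
    proof -
      have "(?b j)\<^sup>2 \<le> 1" using sq that by (smt (verit) zero_le_power2)
      then show ?thesis by (simp add: abs_square_le_1)
    qed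
    moreover have "(\<Sum>j\<le>i. run (heights m x) j) = ?a (Suc i)" if "i \<le> Suc m" for i
      using that run tel[of i] by simp
    ultimately show ?thesis using pf pr by (simp del: sum.atMost_Suc)
  qed
  moreover have "(?a (Suc j) - ?a j)\<^sup>2 + (?b j)\<^sup>2 = 1" if gsf: "?g" "?s" "?f" and j: "j \<le> Suc m" for j
  proof -
    \<comment> \<open>The case \<open>i = Suc m\<close> is the width equation, as vertex
      \<open>m + 2\<close> is pinned at abscissa \<open>r\<close>.\<close>
    have a: "?a (Suc i) = (\<Sum>j\<le>i. run (heights m x) j)" if "i \<le> Suc m" for i
      using that gsf pf pr by (cases "i = Suc m") auto
    have "?a (Suc j) - ?a j = run (heights m x) j"
      using a[of j] a[of "j - 1"] p0 j by (cases j) auto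
    \<comment> \<open>This makes the radicand nonnegative, so that squaring undoes
      \<open>sqrt\<close>.\<close>
    moreover have "(?b j)\<^sup>2 \<le> 1" using gsf j by (simp add: abs_square_le_1)
    ultimately show ?thesis by simp
  qed
  ultimately show ?thesis unfolding L by blast
qed

section \<open>Compactness of the space of oriented polygons\<close>

lemma continuous_map_polygon_vertex:
  assumes "i \<le> n - 1"
  shows "continuous_map (product_topology (\<lambda>_. euclidean) {1..n-2}) euclidean
    (\<lambda>x. polygon_vertex n r x i)"
proof (cases "i \<in> {1..n-2}")
  case True
  then have "polygon_vertex n r x i = x i" for x
    by (auto simp: polygon_vertex_def)
  then show ?thesis
    using continuous_map_product_projection[OF True, of "\<lambda>_. euclidean"] by simp
next
  case False
  then have "polygon_vertex n r x i = (if i = 0 then (0, 0) else (r, 0))" for x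
    using assms by (auto simp: polygon_vertex_def)
  then show ?thesis by simp
qed

text \<open>The side conditions are closed, and they confine vertex \<open>i\<close> to the disc of
  radius \<open>i\<close> about the origin.\<close>

lemma compact_space_oriented_polygon_space:
  assumes "n \<ge> 2"
  shows "compact_space (oriented_polygon_space n r)"
proof -
  let ?P = "product_topology (\<lambda>_. euclidean :: (real \<times> real) topology) {1..n-2}"
  let ?d = "\<lambda>x i. dist (polygon_vertex n r x (i - 1)) (polygon_vertex n r x i)"
  let ?S = "{x. \<forall>i\<in>{1..n-1}. ?d x i = 1}"
  have "closedin ?P {x \<in> topspace ?P. ?d x i \<in> {1}}" if "i \<in> {1..n-1}" for i
  proof (rule closedin_continuous_map_preimage)
    have "continuous_map ?P (prod_topology euclidean euclidean)
        (\<lambda>x. (polygon_vertex n r x (i - 1), polygon_vertex n r x i))"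
      using that by (intro continuous_map_pairedI continuous_map_polygon_vertex) auto
    moreover have "continuous_map (prod_topology euclidean euclidean) euclideanreal
        (\<lambda>(p :: real \<times> real, q). dist p q)"
      by (auto simp: case_prod_unfold intro!: continuous_intros)
    ultimately have "continuous_map ?P euclideanreal
        ((\<lambda>(p, q). dist p q) \<circ> (\<lambda>x. (polygon_vertex n r x (i - 1), polygon_vertex n r x i)))"
      by (rule continuous_map_compose)
    then show "continuous_map ?P euclideanreal (\<lambda>x. ?d x i)"
      by (simp add: o_def)
  qed auto
  then have "closedin ?P (\<Inter>i\<in>{1..n-1}. {x \<in> topspace ?P. ?d x i \<in> {1}})"
    using assms by (intro closedin_INT) auto
  also have "(\<Inter>i\<in>{1..n-1}. {x \<in> topspace ?P. ?d x i \<in> {1}}) = topspace ?P \<inter> ?S"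
  proof -
    \<comment> \<open>Over an empty index set the intersection would be everything instead of
      \<open>topspace ?P\<close>.\<close>
    have "1 \<in> {1..n-1}" using assms by simp
    then show ?thesis by blast
  qed
  finally have closed: "closedin ?P (topspace ?P \<inter> ?S)" .
  have bound: "dist (0, 0) (polygon_vertex n r x i) \<le> real i" if "x \<in> ?S" "i \<le> n - 1" for x i
    using that(2)
  proof (induction i)
    case 0
    then show ?case by (simp add: polygon_vertex_def)
  next
    case (Suc i)
    then have "dist (polygon_vertex n r x i) (polygon_vertex n r x (Suc i)) = 1"
      using that(1) by (auto dest: bspec[of _ _ "Suc i"])
    then show ?case
      using Suc dist_triangle[of "(0, 0)" "polygon_vertex n r x (Suc i)" "polygon_vertex n r x i"]
      by simp
  qed
  have "x i \<in> cball (0, 0) (real i)" if "x \<in> ?S" "i \<in> {1..n-2}" for x i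
  proof -
    have "polygon_vertex n r x i = x i" "i \<le> n - 1"
      using that(2) by (auto simp: polygon_vertex_def)
    then show ?thesis using bound[OF that(1), of i] by simp
  qed
  then have "topspace ?P \<inter> ?S \<subseteq> (\<Pi>\<^sub>E i\<in>{1..n-2}. cball (0, 0) (real i))"
    by (auto simp: PiE_def)
  moreover have "compactin ?P (\<Pi>\<^sub>E i\<in>{1..n-2}. cball (0, 0) (real i))"
    by (simp add: compactin_PiE)
  ultimately have "compactin ?P (topspace ?P \<inter> ?S)"
    using closed closed_compactin by blast
  then show ?thesis
    unfolding oriented_polygon_space_def
    \<comment> \<open>\<open>?S\<close> may contain functions outside \<open>topspace ?P\<close>, so
      it is cut down first.\<close>
    by (subst subtopology_restrict[symmetric]) (rule compact_space_subtopology)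
qed

section \<open>The homeomorphism onto the sphere\<close>

definition height_direction :: "nat \<Rightarrow> (nat \<Rightarrow> real \<times> real) \<Rightarrow> nat \<Rightarrow> real" where
  "height_direction m x i = heights m x i / sqrt (\<Sum>k\<le>m. (heights m x k)\<^sup>2)"

context
  fixes m :: nat and r :: real
  assumes r: "real m + 1 \<le> r" "r < real m + 2"
begin

text \<open>If all heights were zero, the width would be \<open>m + 2 > r\<close>. Hence
  \<open>height_direction\<close> never divides by zero on the polygon space.\<close>

lemma sum_heights_squared_pos:
  assumes x: "x \<in> topspace (oriented_polygon_space (m + 3) r)"
  shows "(\<Sum>k\<le>m. (heights m x k)\<^sup>2) > 0"
proof (rule ccontr)
  assume "\<not> ?thesis"
  then have "(\<Sum>k\<le>m. (heights m x k)\<^sup>2) = 0"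
    by (meson linorder_not_less nle_le sum_nonneg zero_le_power2)
  then have "heights m x k = 0" for k
    by (cases "k \<le> m") (auto simp: sum_nonneg_eq_0_iff heights_def)
  then have "gap (heights m x) j = 0" for j
    by (simp add: gap_def split: nat.split)
  then have "(\<Sum>j\<le>Suc m. run (heights m x) j) = real m + 2" by simp
  then show False
    using x r by (simp add: mem_oriented_polygon_space_iff)
qed

lemma height_direction_in_nsphere:
  assumes "x \<in> topspace (oriented_polygon_space (m + 3) r)"
  shows "height_direction m x \<in> topspace (nsphere m)"
  using sum_heights_squared_pos[OF assms]
  by (auto simp: nsphere height_direction_def power_divide heights_def simp flip: sum_divide_distrib)

lemma continuous_map_height_direction:
  "continuous_map (oriented_polygon_space (m + 3) r) (nsphere m) (height_direction m)"
proof -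
  let ?M = "oriented_polygon_space (m + 3) r"
  have ht: "continuous_map ?M euclideanreal (\<lambda>x. heights m x i)" for i
  proof (cases "i \<le> m")
    case True
    then have "continuous_map ?M euclidean (\<lambda>x. x (Suc i))"
      unfolding oriented_polygon_space_def
      by (intro continuous_map_from_subtopology continuous_map_product_projection) auto
    then have "continuous_map ?M euclideanreal (snd \<circ> (\<lambda>x. x (Suc i)))"
      by (rule continuous_map_compose) (auto intro: continuous_intros)
    then show ?thesis using True by (simp add: heights_def o_def)
  qed (simp add: heights_def)
  have "continuous_map ?M euclideanreal (sqrt \<circ> (\<lambda>x. \<Sum>k\<le>m. (heights m x k)\<^sup>2))"
    by (rule continuous_map_compose[of _ euclideanreal])
      (auto intro!: continuous_intros continuous_map_sum ht)
  then have "continuous_map ?M euclideanreal (\<lambda>x. height_direction m x i)" for i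
    unfolding height_direction_def o_def using sum_heights_squared_pos
    by (intro continuous_map_real_divide ht) fastforce+
  then show ?thesis
    using height_direction_in_nsphere
    by (auto simp: nsphere continuous_map_in_subtopology continuous_map_componentwise_UNIV)
qed

text \<open>Equal directions put both height vectors on one ray, where strict monotonicity leaves a
  single scale of width \<open>r\<close>; equal heights then give equal polygons.\<close>

lemma inj_on_height_direction:
  "inj_on (height_direction m) (topspace (oriented_polygon_space (m + 3) r))"
proof (rule inj_onI)
  fix x y
  assume x: "x \<in> topspace (oriented_polygon_space (m + 3) r)"
    and y: "y \<in> topspace (oriented_polygon_space (m + 3) r)"
    and eq: "height_direction m x = height_direction m y"
  define v where "v = height_direction m x"
  have scale: "\<exists>t>0. heights m z = (\<lambda>i. t * height_direction m z i)"
    if "z \<in> topspace (oriented_polygon_space (m + 3) r)" for z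
    using sum_heights_squared_pos[OF that]
    by (intro exI[of _ "sqrt (\<Sum>k\<le>m. (heights m z k)\<^sup>2)"]) (auto simp: height_direction_def)
  obtain s where s: "s > 0" "heights m x = (\<lambda>i. s * v i)"
    using scale[OF x] by (auto simp: v_def)
  obtain t where t: "t > 0" "heights m y = (\<lambda>i. t * v i)"
    using scale[OF y] by (auto simp: v_def eq)
  have sums: "(\<Sum>j\<le>Suc m. run (heights m x) j) = r" "(\<Sum>j\<le>Suc m. run (heights m y) j) = r"
    using x y r by (simp_all add: mem_oriented_polygon_space_iff)
  have nz: "\<exists>j\<in>{..Suc m}. gap v j \<noteq> 0"
  proof (rule ccontr)
    assume "\<not> ?thesis"
    then have "(\<Sum>j\<le>Suc m. run (heights m x) j) = real m + 2" by (simp add: s gap_scale)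
    then show False using sums r by simp
  qed
  have "s = t"
    using sum_sqrt_scale_strict_antimono[OF _ _ _ nz, of s t]
      sum_sqrt_scale_strict_antimono[OF _ _ _ nz, of t s] s t sums
    by (simp add: gap_scale) (meson less_imp_le less_irrefl linorder_neqE_linordered_idom)
  then have ht: "heights m x = heights m y" using s t by simp
  show "x = y"
  proof (rule extensionalityI)
    show "x \<in> extensional {1..Suc m}" "y \<in> extensional {1..Suc m}"
      using x y r by (simp_all add: mem_oriented_polygon_space_iff)
    fix i assume "i \<in> {1..Suc m}"
    then obtain k where k: "i = Suc k" "k \<le> m" by (cases i) auto
    have "fst (x i) = fst (y i)"
      using x y r k ht by (simp add: mem_oriented_polygon_space_iff)
    moreover have "snd (x i) = snd (y i)"
      using fun_cong[OF ht, of k] k by (simp add: heights_def)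
    ultimately show "x i = y i" by (rule prod_eqI)
  qed
qed

text \<open>The given point is scaled until its width is \<open>r\<close>, and the abscissas are
  then filled in as partial sums.\<close>

lemma height_direction_surj:
  assumes v: "v \<in> topspace (nsphere m)"
  shows "v \<in> height_direction m ` topspace (oriented_polygon_space (m + 3) r)"
proof -
  have v1: "(\<Sum>k\<le>m. (v k)\<^sup>2) = 1" and v0: "\<And>k. k > m \<Longrightarrow> v k = 0"
    using v by (auto simp: nsphere)
  have nz: "\<exists>j\<in>{..Suc m}. gap v j \<noteq> 0"
  proof (rule ccontr)
    assume "\<not> ?thesis"
    \<comment> \<open>The gaps telescope to the entries of \<open>v\<close>.\<close>
    then have "v k = 0" if "k \<le> m" for k
      using that sum_gap[of v k] by simp
    then show False using v1 by simp
  qed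
  obtain t where t: "t > 0" "\<And>j. j \<le> Suc m \<Longrightarrow> \<bar>t * gap v j\<bar> \<le> 1"
      "(\<Sum>j\<le>Suc m. sqrt (1 - (t * gap v j)\<^sup>2)) = r"
    using ex_sum_sqrt_scale_eq[OF _ nz, of r] r by auto
  \<comment> \<open>Vertex \<open>i\<close> is reached along the sides 0 to \<open>i - 1\<close> and
    carries coordinate \<open>i - 1\<close> of the scaled vector.\<close>
  define x where "x = (\<lambda>i\<in>{1..Suc m}. (\<Sum>j<i. sqrt (1 - (t * gap v j)\<^sup>2), t * v (i - 1)))"
  have ht: "heights m x = (\<lambda>i. t * v i)"
    by (auto simp: heights_def x_def v0 fun_eq_iff)
  have "fst (x (Suc i)) = (\<Sum>j\<le>i. sqrt (1 - (t * gap v j)\<^sup>2))" if "i \<le> m" for i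
    using that by (simp add: x_def lessThan_Suc_atMost)
  moreover have "x \<in> extensional {1..Suc m}"
    by (simp add: x_def)
  ultimately have "x \<in> topspace (oriented_polygon_space (m + 3) r)"
    using t by (simp add: mem_oriented_polygon_space_iff[OF r(1)] ht gap_scale)
  \<comment> \<open>The norm of the heights is \<open>t\<close>, since \<open>v\<close> is a unit
    vector and \<open>t > 0\<close>.\<close>
  moreover have "height_direction m x = v"
    using t v1 by (simp add: height_direction_def ht fun_eq_iff power_mult_distrib
        flip: sum_distrib_left)
  ultimately show ?thesis by blast
qed

text \<open>A continuous bijection from a compact space to a Hausdorff space is a
  homeomorphism.\<close>

lemma homeomorphic_map_height_direction:
  "homeomorphic_map (oriented_polygon_space (m + 3) r) (nsphere m) (height_direction m)"
proof (rule continuous_imp_homeomorphic_map)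
  show "compact_space (oriented_polygon_space (m + 3) r)"
    by (simp add: compact_space_oriented_polygon_space)
  show "Hausdorff_space (nsphere m)"
    by (simp add: nsphere Hausdorff_space_subtopology Hausdorff_space_product_topology)
  show "continuous_map (oriented_polygon_space (m + 3) r) (nsphere m) (height_direction m)"
    by (rule continuous_map_height_direction)
  show "height_direction m ` topspace (oriented_polygon_space (m + 3) r) = topspace (nsphere m)"
    using height_direction_in_nsphere height_direction_surj by blast
  show "inj_on (height_direction m) (topspace (oriented_polygon_space (m + 3) r))"
    by (rule inj_on_height_direction)
qed

end

section \<open>Reflection, antipodes and the passage to quotients\<close>

lemma height_direction_reflect_polygon:
  "height_direction m (reflect_polygon (m + 3) x) = (\<lambda>i. - height_direction m x i)"
proof -
  have "heights m (reflect_polygon (m + 3) x) i = - heights m x i" for i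
    by (simp add: heights_def reflect_polygon_def)
  then show ?thesis by (simp add: height_direction_def fun_eq_iff)
qed

theorem corollary1p3:
  fixes n :: nat and r :: real
  assumes "n \<ge> 3" and "real n - 2 \<le> r" and "r < real n - 1"
  shows "polygon_space n r homeomorphic_space real_projective_space (n - 3)"
proof -
  define m where "m = n - 3"
  have n: "n = m + 3" and r: "real m + 1 \<le> r" "r < real m + 2"
    using assms by (simp_all add: m_def)
  let ?M = "oriented_polygon_space (m + 3) r" and ?h = "height_direction m"
  let ?R = "involution_rel (topspace ?M) (reflect_polygon (m + 3))"
  let ?S = "involution_rel (topspace (nsphere m)) (\<lambda>x i. - x i)"
  have "quotient_topology ?M ?R homeomorphic_space quotient_topology (nsphere m) ?S"
  proof (rule homeomorphic_space_quotient_topology)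
    show "homeomorphic_map ?M (nsphere m) ?h"
      using r by (rule homeomorphic_map_height_direction)
    fix x assume x: "x \<in> topspace ?M"
    have R: "?R `` {x} = {x, reflect_polygon (m + 3) x}"
      using x reflect_polygon_in_topspace[OF x] by (auto simp: involution_rel_def)
    show "?R `` {x} \<subseteq> topspace ?M"
      using x reflect_polygon_in_topspace[OF x] by (simp add: R)
    \<comment> \<open>That the antipode of \<open>?h x\<close> lies on the sphere is seen from the
      reflected polygon, whose direction it is.\<close>
    have "?S `` {?h x} = {?h x, \<lambda>i. - ?h x i}"
      using height_direction_in_nsphere[OF r x]
        height_direction_in_nsphere[OF r reflect_polygon_in_topspace[OF x]]
      by (auto simp: involution_rel_def height_direction_reflect_polygon)
    then show "?h ` (?R `` {x}) = ?S `` {?h x}"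
      by (simp add: R height_direction_reflect_polygon)
  qed
  then show ?thesis
    by (simp add: n polygon_space_def real_projective_space_def)
qed

end
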